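(* Let $n\ge 1$, $X=\{1,\ldots,n\}$, and let $S$ be a nonempty subset of the symmetric group $S_n$. A function $F:S\to X$ satisfies the separation property if and only if it is a polynomial on $S$.
   Context: A permutation $\alpha$ of $X=\{1,\ldots,n\}$ is written $\alpha=(x_1\cdots x_n)$ where $x_k=k\alpha$ is the image of $k$ (permutations act on the right). Each permutation $\alpha=(x_1\cdots x_n)$ defines a linear order $<_\alpha$ on $X$ by $x_i<_\alpha x_j\iff i<j$; $\le_\alpha$, $>_\alpha$, $\ge_\alpha$ are defined accordingly, and for $a,b\in X$, $a\wedge b$ and $a\vee b$ evaluated at $\alpha$ denote the minimum and maximum with respect to $\le_\alpha$. For $k\in X$, $G_k:S\to X$ is the constant function $G_k(\alpha)=k$. A function $F:S\to X$ is a polynomial on $S$ if there is a family $\{K_i\}_{i\in I}$ of subsets of $X$ (with $I$ and each $K_i$ nonempty, so that the expression is defined) such that for all $\alpha\in S$, $F(\alpha)=\bigvee_{i\in I}\bigwedge_{j\in K_i}G_j(\alpha)$, where the meets and joins are taken with respect to $\le_\alpha$. A function $F:S\to X$ satisfies the separation property if for any $\alpha,\beta\in S$ there is $u\in X$ with $u\le_\alpha F(\alpha)$ and $u\ge_\beta F(\beta)$. *)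

theory Defs
  imports Complex_Main "HOL-Library.FuncSet" "HOL-Combinatorics.Permutations"
begin

(* A permutation of X = {1..n} is a function \<alpha> with \<alpha> permutes {1..n}; its one-line notation
   is (x_1 ... x_n) with x_k = \<alpha> k. *)

definition perm_less :: "nat \<Rightarrow> (nat \<Rightarrow> nat) \<Rightarrow> nat \<Rightarrow> nat \<Rightarrow> bool" where
  "perm_less n \<alpha> x y \<longleftrightarrow> (\<exists>i\<in>{1..n}. \<exists>j\<in>{1..n}. x = \<alpha> i \<and> y = \<alpha> j \<and> i < j)"

definition perm_le :: "nat \<Rightarrow> (nat \<Rightarrow> nat) \<Rightarrow> nat \<Rightarrow> nat \<Rightarrow> bool" where
  "perm_le n \<alpha> x y \<longleftrightarrow> x = y \<or> perm_less n \<alpha> x y"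

definition perm_meet :: "nat \<Rightarrow> (nat \<Rightarrow> nat) \<Rightarrow> nat set \<Rightarrow> nat" where
  "perm_meet n \<alpha> A = (THE m. m \<in> A \<and> (\<forall>a\<in>A. perm_le n \<alpha> m a))"

definition perm_join :: "nat \<Rightarrow> (nat \<Rightarrow> nat) \<Rightarrow> nat set \<Rightarrow> nat" where
  "perm_join n \<alpha> A = (THE m. m \<in> A \<and> (\<forall>a\<in>A. perm_le n \<alpha> a m))"

definition const_fun :: "nat \<Rightarrow> (nat \<Rightarrow> nat) \<Rightarrow> nat" where
  "const_fun k \<alpha> = k"

(* The family (K_i), i in I, is represented by the set \<K> of its members, i.e. it is indexed
   by itself; HOL cannot quantify existentially over the type of the indices. Lemma
   is_polynomial_onI covers families over an arbitrary index type. *)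
definition is_polynomial_on :: "nat \<Rightarrow> (nat \<Rightarrow> nat) set \<Rightarrow> ((nat \<Rightarrow> nat) \<Rightarrow> nat) \<Rightarrow> bool" where
  "is_polynomial_on n S F \<longleftrightarrow>
     (\<exists>\<K>. \<K> \<noteq> {} \<and> (\<forall>K\<in>\<K>. K \<noteq> {} \<and> K \<subseteq> {1..n}) \<and>
        (\<forall>\<alpha>\<in>S. F \<alpha> = perm_join n \<alpha> ((\<lambda>K. perm_meet n \<alpha> ((\<lambda>j. const_fun j \<alpha>) ` K)) ` \<K>)))"

definition separation_property :: "nat \<Rightarrow> (nat \<Rightarrow> nat) set \<Rightarrow> ((nat \<Rightarrow> nat) \<Rightarrow> nat) \<Rightarrow> bool" where
  "separation_property n S F \<longleftrightarrow>
     (\<forall>\<alpha>\<in>S. \<forall>\<beta>\<in>S. \<exists>u\<in>{1..n}. perm_le n \<alpha> u (F \<alpha>) \<and> perm_le n \<beta> (F \<beta>) u)"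

lemma is_polynomial_onI:
  fixes I :: "'i set" and K :: "'i \<Rightarrow> nat set"
  assumes "I \<noteq> {}" and "\<And>i. i \<in> I \<Longrightarrow> K i \<noteq> {} \<and> K i \<subseteq> {1..n}"
    and "\<And>\<alpha>. \<alpha> \<in> S \<Longrightarrow>
           F \<alpha> = perm_join n \<alpha> ((\<lambda>i. perm_meet n \<alpha> ((\<lambda>j. const_fun j \<alpha>) ` K i)) ` I)"
  shows "is_polynomial_on n S F"
  unfolding is_polynomial_on_def
  by (rule exI[of _ "K ` I"]) (use assms in \<open>simp add: image_image\<close>)

end

theory Submission
  imports Defs
begin

text \<open>
  If \<open>F\<close> is the join of the meets of the \<open>K \<in> \<K>\<close>, then \<open>F \<beta>\<close> is the \<open>\<beta>\<close>-meet of some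
  \<open>K \<in> \<K>\<close>, and the \<open>\<alpha>\<close>-meet of the same \<open>K\<close> separates \<open>\<alpha>\<close> from \<open>\<beta>\<close>.
  Conversely, take for \<open>\<K>\<close> the upper sets \<open>{u. F \<beta> \<le>\<^sub>\<beta> u}\<close> for \<open>\<beta> \<in> S\<close>: the \<open>\<alpha>\<close>-meet of the
  one given by \<open>\<alpha>\<close> is \<open>F \<alpha>\<close>, and separation bounds all the other \<open>\<alpha>\<close>-meets by \<open>F \<alpha>\<close>.
\<close>

text \<open>\<open>inv \<alpha>\<close> gives the position of an element in the one-line notation,
  so the order is the usual one on positions, and its laws are inherited from the natural
  numbers.\<close>

lemma perm_le_iff:
  assumes "\<alpha> permutes {1..n}" "x \<in> {1..n}" "y \<in> {1..n}"
  shows "perm_le n \<alpha> x y \<longleftrightarrow> inv \<alpha> x \<le> inv \<alpha> y"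
proof -
  have "inv \<alpha> x \<in> {1..n}" "inv \<alpha> y \<in> {1..n}"
    using assms(2,3) permutes_in_image[OF permutes_inv[OF assms(1)]] by simp_all
  moreover have "\<alpha> (inv \<alpha> x) = x" "\<alpha> (inv \<alpha> y) = y"
    using assms(1) by (simp_all add: permutes_inverses)
  moreover have "inv \<alpha> (\<alpha> i) = i" for i
    using assms(1) by (simp add: permutes_inverses)
  \<comment> \<open>The witnesses in \<open>perm_less\<close> are forced:
    \<open>x = \<alpha> i\<close> means \<open>i = inv \<alpha> x\<close>.\<close>
  ultimately have "perm_less n \<alpha> x y \<longleftrightarrow> inv \<alpha> x < inv \<alpha> y" "x = y \<longleftrightarrow> inv \<alpha> x = inv \<alpha> y"
    unfolding perm_less_def by metis+
  then show ?thesis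
    unfolding perm_le_def by auto
qed

lemma perm_le_antisym:
  assumes "\<alpha> permutes {1..n}" "x \<in> {1..n}" "y \<in> {1..n}" "perm_le n \<alpha> x y" "perm_le n \<alpha> y x"
  shows "x = y"
proof -
  have "inv \<alpha> x = inv \<alpha> y"
    using assms(4,5) perm_le_iff[OF assms(1-3)] perm_le_iff[OF assms(1,3,2)] by simp
  then show ?thesis
    by (metis assms(1) permutes_inverses(1))
qed

lemma perm_le_trans:
  assumes "\<alpha> permutes {1..n}" "x \<in> {1..n}" "y \<in> {1..n}" "z \<in> {1..n}"
    and "perm_le n \<alpha> x y" "perm_le n \<alpha> y z"
  shows "perm_le n \<alpha> x z"
  using assms(5,6) perm_le_iff[OF assms(1,2,3)] perm_le_iff[OF assms(1,3,4)]
    perm_le_iff[OF assms(1,2,4)] by simp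

text \<open>Antisymmetry makes a minimum unique, so exhibiting one settles the definite
  description.\<close>

lemma perm_meet_eqI:
  assumes "\<alpha> permutes {1..n}" "A \<subseteq> {1..n}" "m \<in> A" "\<And>a. a \<in> A \<Longrightarrow> perm_le n \<alpha> m a"
  shows "perm_meet n \<alpha> A = m"
  unfolding perm_meet_def
proof (rule the_equality)
  fix m' assume m': "m' \<in> A \<and> (\<forall>a\<in>A. perm_le n \<alpha> m' a)"
  show "m' = m"
    by (rule perm_le_antisym[OF assms(1)]) (use m' assms(2-4) in auto)
qed (use assms in simp)

lemma perm_join_eqI:
  assumes "\<alpha> permutes {1..n}" "A \<subseteq> {1..n}" "m \<in> A" "\<And>a. a \<in> A \<Longrightarrow> perm_le n \<alpha> a m"
  shows "perm_join n \<alpha> A = m"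
  unfolding perm_join_def
proof (rule the_equality)
  fix m' assume m': "m' \<in> A \<and> (\<forall>a\<in>A. perm_le n \<alpha> a m')"
  show "m' = m"
    by (rule perm_le_antisym[OF assms(1)]) (use m' assms(2-4) in auto)
qed (use assms in simp)

lemma perm_meet:
  assumes "\<alpha> permutes {1..n}" "A \<subseteq> {1..n}" "A \<noteq> {}"
  shows perm_meet_in: "perm_meet n \<alpha> A \<in> A"
    and perm_meet_le: "a \<in> A \<Longrightarrow> perm_le n \<alpha> (perm_meet n \<alpha> A) a"
proof -
  \<comment> \<open>Every nonempty set has an element of least position, since the natural numbers
    are well-ordered.\<close>
  obtain m where m: "m \<in> A" "\<And>a. a \<in> A \<Longrightarrow> inv \<alpha> m \<le> inv \<alpha> a"
    using assms(3) ex_has_least_nat[of "\<lambda>x. x \<in> A" _ "inv \<alpha>"] by blast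
  then have le: "perm_le n \<alpha> m a" if "a \<in> A" for a
    using that m assms(2) by (subst perm_le_iff[OF assms(1)]) auto
  have eq: "perm_meet n \<alpha> A = m"
    by (rule perm_meet_eqI[OF assms(1,2) m(1) le])
  show "perm_meet n \<alpha> A \<in> A" "a \<in> A \<Longrightarrow> perm_le n \<alpha> (perm_meet n \<alpha> A) a"
    using eq m(1) le by simp_all
qed

lemma perm_join:
  assumes "\<alpha> permutes {1..n}" "A \<subseteq> {1..n}" "A \<noteq> {}"
  shows perm_join_in: "perm_join n \<alpha> A \<in> A"
    and perm_join_ge: "a \<in> A \<Longrightarrow> perm_le n \<alpha> a (perm_join n \<alpha> A)"
proof -
  \<comment> \<open>A greatest position, unlike a least one, calls for finiteness; it comes from
    \<open>A \<subseteq> {1..n}\<close>.\<close>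
  have fin: "finite (inv \<alpha> ` A)"
    by (rule finite_imageI[OF finite_subset[OF assms(2)]]) simp
  then obtain m where m_in: "m \<in> A" and "Max (inv \<alpha> ` A) = inv \<alpha> m"
    using Max_in[OF fin] assms(3) by blast
  then have m: "inv \<alpha> a \<le> inv \<alpha> m" if "a \<in> A" for a
    using Max_ge[OF fin imageI[OF that]] by simp
  then have le: "perm_le n \<alpha> a m" if "a \<in> A" for a
    using that m_in m assms(2) by (subst perm_le_iff[OF assms(1)]) auto
  have eq: "perm_join n \<alpha> A = m"
    by (rule perm_join_eqI[OF assms(1,2) m_in le])
  show "perm_join n \<alpha> A \<in> A" "a \<in> A \<Longrightarrow> perm_le n \<alpha> a (perm_join n \<alpha> A)"
    using eq m_in le by simp_all
qed

lemma polynomial_imp_separation: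
  assumes perm: "\<And>\<alpha>. \<alpha> \<in> S \<Longrightarrow> \<alpha> permutes {1..n}" and poly: "is_polynomial_on n S F"
  shows "separation_property n S F"
  unfolding separation_property_def
proof (intro ballI)
  fix \<alpha> \<beta> assume \<alpha>: "\<alpha> \<in> S" and \<beta>: "\<beta> \<in> S"
  obtain \<K> where ne: "\<K> \<noteq> {}" and \<K>: "\<And>K. K \<in> \<K> \<Longrightarrow> K \<noteq> {} \<and> K \<subseteq> {1..n}"
    and F: "\<And>\<gamma>. \<gamma> \<in> S \<Longrightarrow> F \<gamma> = perm_join n \<gamma> (perm_meet n \<gamma> ` \<K>)"
    using poly unfolding is_polynomial_on_def const_fun_def by auto
  have meets: "perm_meet n \<gamma> ` \<K> \<subseteq> {1..n}" if "\<gamma> \<in> S" for \<gamma>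
    using perm_meet_in[OF perm[OF that]] \<K> by blast
  \<comment> \<open>In a linear order a join is attained, so a single \<open>K\<close> realizes
    \<open>F \<beta>\<close>.\<close>
  obtain K where K: "K \<in> \<K>" "F \<beta> = perm_meet n \<beta> K"
    using perm_join_in[OF perm[OF \<beta>] meets[OF \<beta>]] ne F[OF \<beta>] by auto
  \<comment> \<open>Membership in \<open>K\<close> is what puts this separating element above the
    \<beta>-meet of \<open>K\<close>.\<close>
  have u: "perm_meet n \<alpha> K \<in> K"
    using perm_meet_in[OF perm[OF \<alpha>]] \<K>[OF K(1)] by blast
  show "\<exists>u\<in>{1..n}. perm_le n \<alpha> u (F \<alpha>) \<and> perm_le n \<beta> (F \<beta>) u"
  proof (intro bexI conjI)
    show "perm_le n \<alpha> (perm_meet n \<alpha> K) (F \<alpha>)"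
      using perm_join_ge[OF perm[OF \<alpha>] meets[OF \<alpha>]] ne F[OF \<alpha>] K(1) by simp
    show "perm_le n \<beta> (F \<beta>) (perm_meet n \<alpha> K)"
      using perm_meet_le[OF perm[OF \<beta>]] \<K>[OF K(1)] u K(2) by simp
    show "perm_meet n \<alpha> K \<in> {1..n}"
      using u \<K>[OF K(1)] by blast
  qed
qed

lemma separation_imp_polynomial:
  assumes "S \<noteq> {}" and perm: "\<And>\<alpha>. \<alpha> \<in> S \<Longrightarrow> \<alpha> permutes {1..n}"
    and F: "\<And>\<alpha>. \<alpha> \<in> S \<Longrightarrow> F \<alpha> \<in> {1..n}" and sep: "separation_property n S F"
  shows "is_polynomial_on n S F"
proof -
  define K where "K \<beta> = {u \<in> {1..n}. perm_le n \<beta> (F \<beta>) u}" for \<beta>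
  have in_K: "F \<beta> \<in> K \<beta>" if "\<beta> \<in> S" for \<beta>
    using F[OF that] by (simp add: K_def perm_le_def)
  have K_sub: "K \<beta> \<subseteq> {1..n}" for \<beta>
    by (auto simp: K_def)
  show ?thesis
  \<comment> \<open>The family is indexed by \<open>S\<close> itself, so
    \<open>S \<noteq> {}\<close> makes the join well defined.\<close>
  proof (rule is_polynomial_onI[OF assms(1)])
    show "K \<beta> \<noteq> {} \<and> K \<beta> \<subseteq> {1..n}" if "\<beta> \<in> S" for \<beta>
      using in_K[OF that] K_sub by blast
  next
    fix \<alpha> assume \<alpha>: "\<alpha> \<in> S"
    note p = perm[OF \<alpha>]
    have meet_in: "perm_meet n \<alpha> (K \<beta>) \<in> {1..n}" if "\<beta> \<in> S" for \<beta>
      using perm_meet_in[OF p K_sub] in_K[OF that] K_sub by blast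
    have "perm_join n \<alpha> ((\<lambda>\<beta>. perm_meet n \<alpha> (K \<beta>)) ` S) = F \<alpha>"
    proof (rule perm_join_eqI[OF p])
      show "(\<lambda>\<beta>. perm_meet n \<alpha> (K \<beta>)) ` S \<subseteq> {1..n}"
        using meet_in by blast
      \<comment> \<open>The index \<alpha> contributes \<open>F \<alpha>\<close>, the least element
        of its own upper set, so the bound is attained.\<close>
      have "perm_meet n \<alpha> (K \<alpha>) = F \<alpha>"
        by (rule perm_meet_eqI[OF p K_sub in_K[OF \<alpha>]]) (simp add: K_def)
      then show "F \<alpha> \<in> (\<lambda>\<beta>. perm_meet n \<alpha> (K \<beta>)) ` S"
        using \<alpha> by (metis image_eqI)
    next
      fix a assume "a \<in> (\<lambda>\<beta>. perm_meet n \<alpha> (K \<beta>)) ` S"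
      then obtain \<beta> where \<beta>: "\<beta> \<in> S" "a = perm_meet n \<alpha> (K \<beta>)"
        by blast
      \<comment> \<open>The \<beta>-half of separation places \<open>u\<close> in
        \<open>K \<beta>\<close>, hence above its \<alpha>-meet \<open>a\<close>; the \<alpha>-half
        then bounds \<open>a\<close> by \<open>F \<alpha>\<close> through \<open>u\<close>.\<close>
      obtain u where u: "u \<in> {1..n}" "perm_le n \<alpha> u (F \<alpha>)" "perm_le n \<beta> (F \<beta>) u"
        using sep \<alpha> \<beta>(1) unfolding separation_property_def by blast
      then have "u \<in> K \<beta>"
        by (simp add: K_def)
      then have "perm_le n \<alpha> a u"
        using perm_meet_le[OF p K_sub] \<beta>(2) by auto
      then show "perm_le n \<alpha> a (F \<alpha>)"
        using perm_le_trans[OF p _ u(1) F[OF \<alpha>] _ u(2)] meet_in[OF \<beta>(1)] \<beta>(2) by simp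
    qed
    then show "F \<alpha> = perm_join n \<alpha> ((\<lambda>\<beta>. perm_meet n \<alpha> ((\<lambda>j. const_fun j \<alpha>) ` K \<beta>)) ` S)"
      by (simp add: const_fun_def)
  qed
qed

theorem theorem1:
  fixes n :: nat and S :: "(nat \<Rightarrow> nat) set" and F :: "(nat \<Rightarrow> nat) \<Rightarrow> nat"
  assumes "n \<ge> 1"
    and "S \<noteq> {}" and "S \<subseteq> {\<alpha>. \<alpha> permutes {1..n}}"
    and "F \<in> S \<rightarrow> {1..n}"
  shows "separation_property n S F \<longleftrightarrow> is_polynomial_on n S F"
proof
  have perm: "\<alpha> permutes {1..n}" if "\<alpha> \<in> S" for \<alpha>
    using assms(3) that by auto
  show "is_polynomial_on n S F" if "separation_property n S F"
    using separation_imp_polynomial[OF assms(2) perm funcset_mem[OF assms(4)] that] .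
  show "separation_property n S F" if "is_polynomial_on n S F"
    using polynomial_imp_separation[OF perm that] .
qed

end
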